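(* Let $M,N$ be Polish spaces, let $\mu , \tilde{\mu} \in \mathcal{P}(M)$ and $\nu , \tilde{\nu} \in \mathcal{P}(N)$, and let $c : M \times N \to \mathbb{R}$ be a cost function which is Lipschitz on $M \times N$. Let $T : M \to N$ be an optimal transport map between $\mu$ and $\nu$, and let $\tilde{\gamma}$ be an optimal transport plan between $\tilde{\mu}$ and $\tilde{\nu}$, both for the cost $c$. Assume that $T$ is induced by a potential $\psi : N \to \mathbb{R}$ which is strongly $c$-concave on $D=M\times N$ with modulus $\omega(r) = C r^2$, where $C>0$. Then, with $\gamma_T=(\mathrm{Id},T)_\#\mu$, $$W_1(\gamma_T, \tilde{\gamma}) \leq \varepsilon + \sqrt{\frac{2\, \mathrm{Lip}(c)}{C}\, \varepsilon}, \qquad \text{where } \varepsilon := W_1(\tilde{\mu},\mu) + W_1(\nu,\tilde{\nu}).$$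
   Context: $\mathcal{P}(X)$ is the set of Borel probability measures on $X$. $d_M,d_N$ are the distances on $M,N$, and $M\times N$ carries the distance $d_{M \times N}((x,y),(x',y')) = d_M(x,x') + d_N(y,y')$; $W_1$ denotes the $1$-Wasserstein distance for the relevant distance ($d_M$, $d_N$ or $d_{M\times N}$), and $\mathrm{Lip}(c)$ is the Lipschitz constant of $c$ with respect to $d_{M\times N}$. Standing assumption on the cost: $c$ is bounded below. $\Gamma(\mu,\nu)$ is the set of probability measures on $M\times N$ with marginals $\mu,\nu$ (transport plans); a plan is optimal if it minimizes $\int c\,d\gamma$ over $\Gamma(\mu,\nu)$. A transport map from $\mu$ to $\nu$ is a measurable map $T$ with $T_\#\mu=\nu$; it is optimal if it minimizes $\int_M c(x,T(x))\,d\mu(x)$ among such maps. $T$ is induced by $\psi$ if $T(x)\in \operatorname{argmin}_{y\in N}\, c(x,y)-\psi(y)$ for every $x\in M$. The $c$-superdifferential of $\psi$ at $y\in N$ is $\partial^c \psi(y) = \{x \in M \mid \forall z \in N,\ \psi(z) - c(x,z) \leq \psi(y) - c(x,y)\}$, and $\psi$ is $c$-concave if $\partial^c\psi(y)\neq\emptyset$ for every $y\in N$. A $c$-concave function $\psi$ is strongly $c$-concave on $D\subseteq M\times N$ with modulus $\omega$ if for all $x,y,z$ such that $(x,y) \in D$, $(x,z) \in D$ and $x \in \partial^c \psi(y)$ one has $\psi(z) - c(x,z) \leq \psi(y) - c(x, y) - \omega(d_N(y,z))$.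
   Formalization: The formal theorem additionally assumes that the optimal plan γ̃ has finite cost ∫c dγ̃ < ∞; without this every plan may have infinite cost, all are vacuously optimal, and the stated bound can fail. *)

theory Defs
  imports "HOL-Probability.Probability"
begin

definition borel_prob :: "'a::topological_space measure set" where
  "borel_prob = {\<mu>. sets \<mu> = sets borel \<and> prob_space \<mu>}"

definition transport_plans ::
  "'a::topological_space measure \<Rightarrow> 'b::topological_space measure \<Rightarrow> ('a \<times> 'b) measure set" where
  "transport_plans \<mu> \<nu> = {\<gamma> \<in> borel_prob. distr \<gamma> borel fst = \<mu> \<and> distr \<gamma> borel snd = \<nu>}"

definition transport_maps ::
  "'a::topological_space measure \<Rightarrow> 'b::topological_space measure \<Rightarrow> ('a \<Rightarrow> 'b) set" where
  "transport_maps \<mu> \<nu> = {T \<in> borel_measurable \<mu>. distr \<mu> borel T = \<nu>}"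

text \<open>
  The distance is an explicit argument because the library metric on a product type is the
  Euclidean combination of the two metrics, not their sum. On arbitrary Borel probability
  measures the value may be infinite.
\<close>

definition W1 :: "('a::topological_space \<Rightarrow> 'a \<Rightarrow> real) \<Rightarrow> 'a measure \<Rightarrow> 'a measure \<Rightarrow> ennreal" where
  "W1 d \<mu> \<nu> = (INF \<gamma>\<in>transport_plans \<mu> \<nu>. \<integral>\<^sup>+p. ennreal (d (fst p) (snd p)) \<partial>\<gamma>)"

definition sum_dist :: "'a::metric_space \<times> 'b::metric_space \<Rightarrow> 'a \<times> 'b \<Rightarrow> real" where
  "sum_dist p q = dist (fst p) (fst q) + dist (snd p) (snd q)"

definition lipschitz_bounds :: "('a \<Rightarrow> 'a \<Rightarrow> real) \<Rightarrow> ('a \<Rightarrow> real) \<Rightarrow> real set" where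
  "lipschitz_bounds d f = {L. 0 \<le> L \<and> (\<forall>p q. \<bar>f p - f q\<bar> \<le> L * d p q)}"

definition is_lipschitz :: "('a \<Rightarrow> 'a \<Rightarrow> real) \<Rightarrow> ('a \<Rightarrow> real) \<Rightarrow> bool" where
  "is_lipschitz d f \<longleftrightarrow> lipschitz_bounds d f \<noteq> {}"

definition Lip :: "('a \<Rightarrow> 'a \<Rightarrow> real) \<Rightarrow> ('a \<Rightarrow> real) \<Rightarrow> real" where
  "Lip d f = Inf (lipschitz_bounds d f)"

text \<open>
  The Bochner integral of a non-integrable function is 0, so costs are measured by the extended
  integral of the positive part minus that of the negative part. When the integrand is bounded
  below and the measure is a probability measure, the subtrahend is finite.
\<close>

definition ext_integral :: "'a measure \<Rightarrow> ('a \<Rightarrow> real) \<Rightarrow> ereal" where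
  "ext_integral \<mu> f =
     enn2ereal (\<integral>\<^sup>+x. ennreal (f x) \<partial>\<mu>) - enn2ereal (\<integral>\<^sup>+x. ennreal (- f x) \<partial>\<mu>)"

definition optimal_plan ::
  "('a::topological_space \<times> 'b::topological_space \<Rightarrow> real) \<Rightarrow> 'a measure \<Rightarrow> 'b measure
     \<Rightarrow> ('a \<times> 'b) measure \<Rightarrow> bool" where
  "optimal_plan c \<mu> \<nu> \<gamma> \<longleftrightarrow>
     is_arg_min (\<lambda>\<gamma>'. ext_integral \<gamma>' c) (\<lambda>\<gamma>'. \<gamma>' \<in> transport_plans \<mu> \<nu>) \<gamma>"

definition optimal_map ::
  "('a::topological_space \<times> 'b::topological_space \<Rightarrow> real) \<Rightarrow> 'a measure \<Rightarrow> 'b measure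
     \<Rightarrow> ('a \<Rightarrow> 'b) \<Rightarrow> bool" where
  "optimal_map c \<mu> \<nu> T \<longleftrightarrow>
     is_arg_min (\<lambda>S. ext_integral \<mu> (\<lambda>x. c (x, S x))) (\<lambda>S. S \<in> transport_maps \<mu> \<nu>) T"

definition plan_of_map ::
  "'a::topological_space measure \<Rightarrow> ('a \<Rightarrow> 'b::topological_space) \<Rightarrow> ('a \<times> 'b) measure" where
  "plan_of_map \<mu> T = distr \<mu> borel (\<lambda>x. (x, T x))"

definition induced_by :: "('a \<times> 'b \<Rightarrow> real) \<Rightarrow> ('b \<Rightarrow> real) \<Rightarrow> ('a \<Rightarrow> 'b) \<Rightarrow> bool" where
  "induced_by c \<psi> T \<longleftrightarrow> (\<forall>x. is_arg_min (\<lambda>y. c (x, y) - \<psi> y) (\<lambda>y. y \<in> UNIV) (T x))"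

definition c_superdifferential :: "('a \<times> 'b \<Rightarrow> real) \<Rightarrow> ('b \<Rightarrow> real) \<Rightarrow> 'b \<Rightarrow> 'a set" where
  "c_superdifferential c \<psi> y = {x. \<forall>z. \<psi> z - c (x, z) \<le> \<psi> y - c (x, y)}"

definition c_concave :: "('a \<times> 'b \<Rightarrow> real) \<Rightarrow> ('b \<Rightarrow> real) \<Rightarrow> bool" where
  "c_concave c \<psi> \<longleftrightarrow> (\<forall>y. c_superdifferential c \<psi> y \<noteq> {})"

definition strongly_c_concave_on ::
  "('a \<times> 'b::metric_space) set \<Rightarrow> (real \<Rightarrow> real) \<Rightarrow> ('a \<times> 'b \<Rightarrow> real) \<Rightarrow> ('b \<Rightarrow> real) \<Rightarrow> bool" where
  "strongly_c_concave_on D \<omega> c \<psi> \<longleftrightarrow> c_concave c \<psi> \<and>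
     (\<forall>x y z. (x, y) \<in> D \<longrightarrow> (x, z) \<in> D \<longrightarrow> x \<in> c_superdifferential c \<psi> y \<longrightarrow>
        \<psi> z - c (x, z) \<le> \<psi> y - c (x, y) - \<omega> (dist y z))"

definition ennreal_sqrt :: "ennreal \<Rightarrow> ennreal" where
  "ennreal_sqrt a = (if a = \<infinity> then \<infinity> else ennreal (sqrt (enn2real a)))"

end

theory Submission
  imports Defs
begin

text \<open>
  Write \<open>L\<close> for the Lipschitz constant of \<open>c\<close>, and let the two Wasserstein distances on the right
  be finite, as the bound is trivial otherwise. Take couplings \<open>\<pi>\<close> of \<open>\<mu>'\<close> and \<open>\<mu>\<close> and \<open>\<sigma>\<close> of \<open>\<nu>\<close> and
  \<open>\<nu>'\<close> whose mean displacements \<open>I\<close> and \<open>J\<close> are finite and close to the Wasserstein distances. Let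
  \<open>x'\<close>, \<open>x\<close>, \<open>y'\<close> be random with \<open>(x', x)\<close> distributed as \<open>\<pi>\<close> and \<open>(x', y')\<close> as \<open>\<gamma>'\<close>. Then
  \<open>((x, T x), (x', y'))\<close> couples the two plans, at expected distance \<open>I + E d(T x, y')\<close>. Since \<open>T x\<close>
  minimises \<open>c(x, y) - \<psi> y\<close> over \<open>y\<close>, strong concavity gives pointwise
  \<open>C d(T x, y')^2 \<le> (c(x, y') - c(x, T x)) + (\<psi>(T x) - \<psi>(y'))\<close>.
  In the mean each bracket is small. A \<open>c\<close>-concave \<open>\<psi>\<close> is \<open>L\<close>-Lipschitz, so the second bracket
  costs at most \<open>L J\<close>. In the first, replacing \<open>c(x, y')\<close> by \<open>c(x', y')\<close> costs \<open>L I\<close>, and by optimality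
  of \<open>\<gamma>'\<close> the mean of \<open>c(x', y')\<close> is at most that of the plan obtained by transporting along \<open>\<pi>\<close>, then
  \<open>T\<close>, then \<open>\<sigma>\<close>, hence exceeds the cost of \<open>T\<close> by at most \<open>L (I + J)\<close>
  (\<open>optimal_cost_le_map_cost\<close>). Altogether \<open>C E d(T x, y')^2 \<le> 2 L (I + J)\<close>, and Jensen's inequality
  bounds \<open>E d(T x, y')\<close> by the square root in the claim (\<open>W1_plan_of_map_le\<close>).

  Two points need care. Gluing \<open>\<pi>\<close> to \<open>\<gamma>'\<close> exactly would require a disintegration of measures.
  Since \<open>W1\<close> is an infimum, it is enough that the two copies of \<open>x'\<close> stay within distance \<open>\<delta>\<close>, and
  such a coupling has an explicit density once the space is cut into countably many cells of
  diameter below \<open>\<delta>\<close> (\<open>approximate_gluing\<close>). The second point is that the integrals above must be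
  finite for them to be split, although no moment of the four measures is assumed finite. Here a
  quadratic modulus helps: together with the Lipschitz bounds it forces
  \<open>C d(y, z)^2 \<le> 2 L d(y, z)\<close> for all \<open>y\<close> and \<open>z\<close>, so the target space has diameter at most
  \<open>2 L / C\<close> and \<open>\<psi>\<close> is bounded (\<open>strongly_c_concave_bounded_dist\<close>).
\<close>

section \<open>Approximate gluing of couplings\<close>

text \<open>
  Two discrete random variables with the same law can be made equal: draw their common value \<open>n\<close>,
  then draw independently from \<open>P\<close> conditioned on \<open>k = n\<close> and from \<open>Q\<close> conditioned on \<open>l = n\<close>.
  Relative to the product measure this has density \<open>1 / P(k = n)\<close> on \<open>k = l = n\<close> and \<open>0\<close> elsewhere.
\<close>

lemma discrete_coupling:
  fixes k :: "'a \<Rightarrow> nat" and l :: "'b \<Rightarrow> nat"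
  assumes "prob_space P" "prob_space Q"
    and k[measurable]: "k \<in> P \<rightarrow>\<^sub>M count_space UNIV"
    and l[measurable]: "l \<in> Q \<rightarrow>\<^sub>M count_space UNIV"
    and eq: "distr P (count_space UNIV) k = distr Q (count_space UNIV) l"
  obtains R where "sets R = sets (P \<Otimes>\<^sub>M Q)" "distr R P fst = P" "distr R Q snd = Q"
    "AE r in R. k (fst r) = l (snd r)"
proof -
  interpret P: prob_space P by fact
  interpret Q: prob_space Q by fact
  interpret PQ: pair_prob_space P Q ..
  define p where "p n = emeasure P (k -` {n} \<inter> space P)" for n
  define h where "h r = (if k (fst r) = l (snd r) then 1 / p (k (fst r)) else 0)" for r
  define R where "R = density (P \<Otimes>\<^sub>M Q) h"
  have pQ: "p n = emeasure Q (l -` {n} \<inter> space Q)" for n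
    using arg_cong[OF eq, of "\<lambda>M. emeasure M {n}"] by (simp add: p_def emeasure_distr)
  have [measurable]: "(\<lambda>r. p (k (fst r))) \<in> borel_measurable (P \<Otimes>\<^sub>M Q)"
    by (rule measurable_compose[OF measurable_compose[OF measurable_fst k]]) simp
  have "Measurable.pred (P \<Otimes>\<^sub>M Q) (\<lambda>r. \<exists>n. k (fst r) = n \<and> l (snd r) = n)"
    by measurable
  then have [measurable]: "Measurable.pred (P \<Otimes>\<^sub>M Q) (\<lambda>r. k (fst r) = l (snd r))"
    by (simp add: eq_commute)
  have [measurable]: "h \<in> borel_measurable (P \<Otimes>\<^sub>M Q)"
    unfolding h_def by measurable
  have div1: "1 / p n * p n = 1" if "p n \<noteq> 0" for n
    using that by (simp add: p_def ennreal_divide_times P.emeasure_eq_measure ennreal_divide_self)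
  \<comment> \<open>Values of probability zero, where the division is meaningless, are taken on a null set.\<close>
  have AEk: "AE a in P. p (k a) \<noteq> 0"
  proof -
    have "AE a in P. \<forall>n. k a = n \<longrightarrow> p n \<noteq> 0"
    proof (subst AE_all_countable, rule allI)
      fix n show "AE a in P. k a = n \<longrightarrow> p n \<noteq> 0"
      proof (cases "p n = 0")
        case True
        then show ?thesis
          by (intro AE_I[where N="k -` {n} \<inter> space P"]) (auto simp: p_def)
      qed simp
    qed
    then show ?thesis by simp
  qed
  have AEl: "AE b in Q. p (l b) \<noteq> 0"
  proof -
    have "AE b in Q. \<forall>n. l b = n \<longrightarrow> p n \<noteq> 0"
    proof (subst AE_all_countable, rule allI)
      fix n show "AE b in Q. l b = n \<longrightarrow> p n \<noteq> 0"
      proof (cases "p n = 0")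
        case True
        then show ?thesis
          by (intro AE_I[where N="l -` {n} \<inter> space Q"]) (auto simp: pQ)
      qed simp
    qed
    then show ?thesis by simp
  qed
  have in1: "(\<integral>\<^sup>+b. h (a, b) \<partial>Q) = 1" if "p (k a) \<noteq> 0" for a
  proof -
    have "(\<integral>\<^sup>+b. h (a, b) \<partial>Q) = (\<integral>\<^sup>+b. 1 / p (k a) * indicator (l -` {k a} \<inter> space Q) b \<partial>Q)"
      by (intro nn_integral_cong) (auto simp: h_def indicator_def)
    also have "\<dots> = 1 / p (k a) * p (k a)"
      by (subst nn_integral_cmult_indicator) (auto simp: pQ)
    finally show ?thesis using div1[OF that] by simp
  qed
  have in2: "(\<integral>\<^sup>+a. h (a, b) \<partial>P) = 1" if "p (l b) \<noteq> 0" for b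
  proof -
    have "(\<integral>\<^sup>+a. h (a, b) \<partial>P) = (\<integral>\<^sup>+a. 1 / p (l b) * indicator (k -` {l b} \<inter> space P) a \<partial>P)"
      by (intro nn_integral_cong) (auto simp: h_def indicator_def)
    also have "\<dots> = 1 / p (l b) * p (l b)"
      by (subst nn_integral_cmult_indicator) (auto simp: p_def)
    finally show ?thesis using div1[OF that] by simp
  qed
  have "distr R P fst = P"
  proof (rule measure_eqI)
    fix A assume "A \<in> sets (distr R P fst)"
    then have A[measurable]: "A \<in> sets P" by simp
    have "emeasure (distr R P fst) A = (\<integral>\<^sup>+r. h r * indicator A (fst r) \<partial>(P \<Otimes>\<^sub>M Q))"
      unfolding R_def
      by (subst emeasure_distr, simp, simp, subst emeasure_density)
         (auto intro!: nn_integral_cong split: split_indicator)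
    also have "\<dots> = (\<integral>\<^sup>+a. \<integral>\<^sup>+b. h (a, b) * indicator A a \<partial>Q \<partial>P)"
      by (subst Q.nn_integral_fst[symmetric]) auto
    also have "\<dots> = (\<integral>\<^sup>+a. indicator A a \<partial>P)"
    proof (rule nn_integral_cong_AE, use AEk in eventually_elim)
      fix a assume "p (k a) \<noteq> 0"
      then show "(\<integral>\<^sup>+b. h (a, b) * indicator A a \<partial>Q) = indicator A a"
        by (cases "a \<in> A") (simp_all add: in1)
    qed
    also have "\<dots> = emeasure P A" by simp
    finally show "emeasure (distr R P fst) A = emeasure P A" .
  qed simp
  moreover have "distr R Q snd = Q"
  proof (rule measure_eqI)
    fix A assume "A \<in> sets (distr R Q snd)"
    then have A[measurable]: "A \<in> sets Q" by simp
    have "emeasure (distr R Q snd) A = (\<integral>\<^sup>+r. h r * indicator A (snd r) \<partial>(P \<Otimes>\<^sub>M Q))"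
      unfolding R_def
      by (subst emeasure_distr, simp, simp, subst emeasure_density)
         (auto intro!: nn_integral_cong split: split_indicator)
    also have "\<dots> = (\<integral>\<^sup>+b. \<integral>\<^sup>+a. h (a, b) * indicator A b \<partial>P \<partial>Q)"
      by (subst PQ.nn_integral_snd[symmetric]) auto
    also have "\<dots> = (\<integral>\<^sup>+b. indicator A b \<partial>Q)"
    proof (rule nn_integral_cong_AE, use AEl in eventually_elim)
      fix b assume "p (l b) \<noteq> 0"
      then show "(\<integral>\<^sup>+a. h (a, b) * indicator A b \<partial>P) = indicator A b"
        by (cases "b \<in> A") (simp_all add: in2)
    qed
    also have "\<dots> = emeasure Q A" by simp
    finally show "emeasure (distr R Q snd) A = emeasure Q A" .
  qed simp
  moreover have "AE r in R. k (fst r) = l (snd r)"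
    unfolding R_def by (subst AE_density) (auto simp: h_def)
  ultimately show ?thesis
    using that[of R] by (simp add: R_def)
qed

lemma countable_partition_small:
  fixes \<delta> :: real
  assumes "\<delta> > 0"
  obtains k :: "'a::{metric_space, second_countable_topology} \<Rightarrow> nat"
  where "k \<in> borel \<rightarrow>\<^sub>M count_space UNIV" "\<And>x y. k x = k y \<Longrightarrow> dist x y < \<delta>"
proof -
  obtain D :: "'a set" where D: "countable D" "\<And>X. open X \<Longrightarrow> X \<noteq> {} \<Longrightarrow> \<exists>d\<in>D. d \<in> X"
    by (rule countable_dense_setE) blast
  have ne: "D \<noteq> {}" using D(2)[of UNIV] by auto
  \<comment> \<open>Cells: sort the points by the first element of a dense sequence at distance below \<open>\<delta> / 2\<close>.\<close>
  define q where "q = from_nat_into D"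
  define k where "k x = (LEAST n. dist (q n) x < \<delta> / 2)" for x
  have k: "dist (q (k x)) x < \<delta> / 2" for x
  proof -
    obtain d where "d \<in> D" "d \<in> ball x (\<delta> / 2)"
      using D(2)[of "ball x (\<delta> / 2)"] assms by auto
    moreover then obtain n where "d = q n"
      using from_nat_into_surj[OF D(1)] unfolding q_def by metis
    ultimately have "dist (q n) x < \<delta> / 2" by (simp add: dist_commute)
    then show ?thesis unfolding k_def by (rule LeastI)
  qed
  show ?thesis
  proof
    show "k \<in> borel \<rightarrow>\<^sub>M count_space UNIV" unfolding k_def by measurable
    show "dist x y < \<delta>" if "k x = k y" for x y
      using k[of x] k[of y] that dist_triangle2[of x y "q (k x)"]
      by (simp add: dist_commute)
  qed
qed

lemma transport_plansD:
  assumes "\<gamma> \<in> transport_plans \<mu> \<nu>"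
  shows "prob_space \<gamma>" "sets \<gamma> = sets borel" "distr \<gamma> borel fst = \<mu>" "distr \<gamma> borel snd = \<nu>"
  using assms by (auto simp: transport_plans_def borel_prob_def)

text \<open>
  The gluing lemma up to an error \<open>\<delta>\<close>. The cell indices of \<open>f\<close> under \<open>P\<close> and of \<open>g\<close> under \<open>Q\<close> have equal
  laws, so they can be coupled to agree, and then \<open>f\<close> and \<open>g\<close> fall into the same small cell. The
  marginals are exactly \<open>P\<close> and \<open>Q\<close>; only the identification of \<open>f\<close> with \<open>g\<close> is approximate.
\<close>

lemma approximate_gluing:
  fixes P :: "'a::second_countable_topology measure" and Q :: "'b::second_countable_topology measure"
    and f :: "'a \<Rightarrow> 'c::{metric_space, second_countable_topology}"
  assumes P: "P \<in> borel_prob" and Q: "Q \<in> borel_prob"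
    and f: "f \<in> borel_measurable borel" and g: "g \<in> borel_measurable borel"
    and eq: "distr P borel f = distr Q borel g" and "\<delta> > 0"
  obtains R where "R \<in> transport_plans P Q" "AE r in R. dist (f (fst r)) (g (snd r)) < \<delta>"
proof -
  obtain k :: "'c \<Rightarrow> nat" where k[measurable]: "k \<in> borel \<rightarrow>\<^sub>M count_space UNIV"
    and small: "\<And>x y. k x = k y \<Longrightarrow> dist x y < \<delta>"
    using countable_partition_small[OF \<open>\<delta> > 0\<close>] by blast
  have sP[measurable_cong]: "sets P = sets borel" and sQ[measurable_cong]: "sets Q = sets borel"
    and pP: "prob_space P" and pQ: "prob_space Q"
    using P Q by (auto simp: borel_prob_def)
  note f[measurable] g[measurable]
  have "distr P (count_space UNIV) (\<lambda>a. k (f a)) = distr Q (count_space UNIV) (\<lambda>b. k (g b))"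
    using arg_cong[OF eq, of "\<lambda>M. distr M (count_space UNIV) k"]
    by (simp add: distr_distr comp_def)
  then obtain R where R: "sets R = sets (P \<Otimes>\<^sub>M Q)" "distr R P fst = P" "distr R Q snd = Q"
    "AE r in R. k (f (fst r)) = k (g (snd r))"
    using discrete_coupling[of P Q "\<lambda>a. k (f a)" "\<lambda>b. k (g b)"] pP pQ by auto
  have sR: "sets R = sets borel"
    unfolding R(1) borel_prod[symmetric] using sP sQ by (rule sets_pair_measure_cong)
  have fst: "fst \<in> R \<rightarrow>\<^sub>M P" by (simp add: measurable_cong_sets[OF R(1) refl])
  have "prob_space R"
    using prob_space_distrD[OF fst] R(2) pP by simp
  moreover have "distr R borel fst = P" "distr R borel snd = Q"
    using R(2,3) distr_cong[OF refl sP[symmetric], of R fst fst]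
      distr_cong[OF refl sQ[symmetric], of R snd snd] by simp_all
  ultimately have "R \<in> transport_plans P Q"
    using sR by (simp add: transport_plans_def borel_prob_def)
  moreover have "AE r in R. dist (f (fst r)) (g (snd r)) < \<delta>"
    using R(4) by eventually_elim (rule small)
  ultimately show ?thesis by (rule that)
qed

section \<open>Marginals of transport plans\<close>

lemma
  fixes f :: "'a::second_countable_topology \<Rightarrow> real"
    and \<gamma> :: "('a \<times> 'b::second_countable_topology) measure"
  assumes \<gamma>: "\<gamma> \<in> transport_plans \<mu> \<nu>" and f: "f \<in> borel_measurable borel"
  shows integrable_fst_marginal: "integrable \<gamma> (\<lambda>p. f (fst p)) \<longleftrightarrow> integrable \<mu> f"
    and integral_fst_marginal: "(\<integral>p. f (fst p) \<partial>\<gamma>) = (\<integral>x. f x \<partial>\<mu>)"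
proof -
  have m: "fst \<in> \<gamma> \<rightarrow>\<^sub>M borel"
    using measurable_fst[of "borel::'a measure" "borel::'b measure"]
    by (simp add: borel_prod measurable_cong_sets[OF transport_plansD(2)[OF \<gamma>] refl])
  show "integrable \<gamma> (\<lambda>p. f (fst p)) \<longleftrightarrow> integrable \<mu> f"
    using integrable_distr_eq[OF m f] transport_plansD(3)[OF \<gamma>] by simp
  show "(\<integral>p. f (fst p) \<partial>\<gamma>) = (\<integral>x. f x \<partial>\<mu>)"
    using integral_distr[OF m f] transport_plansD(3)[OF \<gamma>] by simp
qed

lemma
  fixes f :: "'b::second_countable_topology \<Rightarrow> real"
    and \<gamma> :: "('a::second_countable_topology \<times> 'b) measure"
  assumes \<gamma>: "\<gamma> \<in> transport_plans \<mu> \<nu>" and f: "f \<in> borel_measurable borel"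
  shows integrable_snd_marginal: "integrable \<gamma> (\<lambda>p. f (snd p)) \<longleftrightarrow> integrable \<nu> f"
    and integral_snd_marginal: "(\<integral>p. f (snd p) \<partial>\<gamma>) = (\<integral>x. f x \<partial>\<nu>)"
proof -
  have m: "snd \<in> \<gamma> \<rightarrow>\<^sub>M borel"
    using measurable_snd[of "borel::'a measure" "borel::'b measure"]
    by (simp add: borel_prod measurable_cong_sets[OF transport_plansD(2)[OF \<gamma>] refl])
  show "integrable \<gamma> (\<lambda>p. f (snd p)) \<longleftrightarrow> integrable \<nu> f"
    using integrable_distr_eq[OF m f] transport_plansD(4)[OF \<gamma>] by simp
  show "(\<integral>p. f (snd p) \<partial>\<gamma>) = (\<integral>x. f x \<partial>\<nu>)"
    using integral_distr[OF m f] transport_plansD(4)[OF \<gamma>] by simp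
qed

lemma transport_plan_marginals:
  fixes \<gamma> :: "('a::second_countable_topology \<times> 'b::second_countable_topology) measure"
  assumes "\<gamma> \<in> transport_plans \<mu> \<nu>"
  shows "\<mu> \<in> borel_prob" "\<nu> \<in> borel_prob"
proof -
  have [measurable_cong]: "sets \<gamma> = sets (borel \<Otimes>\<^sub>M borel)"
    using transport_plansD(2)[OF assms] by (simp only: borel_prod)
  have "prob_space (distr \<gamma> borel fst)" "prob_space (distr \<gamma> borel snd)"
    using transport_plansD(1)[OF assms] by (auto intro: prob_space.prob_space_distr)
  then show "\<mu> \<in> borel_prob" "\<nu> \<in> borel_prob"
    using transport_plansD(3,4)[OF assms] by (auto simp: borel_prob_def)
qed

lemma distr_transport_plan:
  fixes R :: "'a::topological_space measure"
  assumes "prob_space R" and f: "f \<in> R \<rightarrow>\<^sub>M borel" and g: "g \<in> R \<rightarrow>\<^sub>M borel"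
    and "distr R borel f = \<mu>" "distr R borel g = \<nu>"
  shows "distr R borel (\<lambda>r. (f r :: 'b::second_countable_topology, g r :: 'c::second_countable_topology))
    \<in> transport_plans \<mu> \<nu>"
proof -
  have m[measurable]: "(\<lambda>r. (f r, g r)) \<in> R \<rightarrow>\<^sub>M borel"
    using f g by (simp add: borel_prod[symmetric])
  have [measurable]: "fst \<in> (borel :: ('b \<times> 'c) measure) \<rightarrow>\<^sub>M borel"
    "snd \<in> (borel :: ('b \<times> 'c) measure) \<rightarrow>\<^sub>M borel"
    by (simp_all add: borel_prod[symmetric])
  have "prob_space (distr R borel (\<lambda>r. (f r, g r)))"
    using assms(1) m by (rule prob_space.prob_space_distr)
  then show ?thesis
    using assms(4,5) by (simp add: transport_plans_def borel_prob_def distr_distr comp_def)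
qed

lemma borel_measurable_compose_Pair:
  fixes c :: "'a::second_countable_topology \<times> 'b::second_countable_topology \<Rightarrow> 'c::topological_space"
  assumes "c \<in> borel_measurable borel" "f \<in> borel_measurable M" "g \<in> borel_measurable M"
  shows "(\<lambda>s. c (f s, g s)) \<in> borel_measurable M"
  using assms(2,3)
  by (intro measurable_compose[OF _ assms(1)]) (simp add: borel_prod[symmetric])

section \<open>Lipschitz costs and their integrals\<close>

text \<open>The infimum defining the Lipschitz constant is attained, so \<open>Lip d f\<close> is itself a bound.\<close>

lemma Lip_bound:
  assumes "is_lipschitz d f" and d: "\<And>p q. 0 \<le> d p q"
  shows "0 \<le> Lip d f" "\<bar>f p - f q\<bar> \<le> Lip d f * d p q"
proof -
  have ne: "lipschitz_bounds d f \<noteq> {}" using assms(1) by (simp add: is_lipschitz_def)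
  show "0 \<le> Lip d f" unfolding Lip_def
    by (rule cInf_greatest[OF ne]) (auto simp: lipschitz_bounds_def)
  show "\<bar>f p - f q\<bar> \<le> Lip d f * d p q"
  proof (cases "d p q = 0")
    case True
    then show ?thesis using ne by (auto simp: lipschitz_bounds_def) (metis mult_zero_right abs_le_zero_iff diff_eq_eq add_0)
  next
    case False
    then have pos: "d p q > 0" using d[of p q] by simp
    have "\<bar>f p - f q\<bar> / d p q \<le> Lip d f" unfolding Lip_def
      using pos by (intro cInf_greatest[OF ne]) (auto simp: lipschitz_bounds_def divide_le_eq)
    then show ?thesis using pos by (simp add: divide_le_eq)
  qed
qed

text \<open>
  The metric of the product type is the Euclidean combination of the two distances. It
  dominates each of them, so the Lipschitz constant for it is at most twice as large.
\<close>

lemma continuous_if_lipschitz_sum_dist: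
  fixes c :: "'a::metric_space \<times> 'b::metric_space \<Rightarrow> real"
  assumes lip: "\<And>p q. \<bar>c p - c q\<bar> \<le> L * sum_dist p q" and "0 \<le> L"
  shows "continuous_on UNIV c"
proof (rule lipschitz_on_continuous_on, rule lipschitz_onI)
  fix p q :: "'a \<times> 'b"
  have "sum_dist p q \<le> 2 * dist p q"
    using dist_fst_le[of p q] dist_snd_le[of p q] by (simp add: sum_dist_def)
  then have "L * sum_dist p q \<le> (2 * L) * dist p q"
    using \<open>0 \<le> L\<close> mult_left_mono by fastforce
  then show "dist (c p) (c q) \<le> (2 * L) * dist p q"
    using lip[of p q] by (simp add: dist_real_def)
qed (use \<open>0 \<le> L\<close> in simp)

lemma ext_integral_eq_integral:
  assumes "integrable M f"
  shows "ext_integral M f = ereal (\<integral>x. f x \<partial>M)"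
proof -
  have "(\<integral>\<^sup>+x. ennreal (f x) \<partial>M) < \<infinity>" "(\<integral>\<^sup>+x. ennreal (- f x) \<partial>M) < \<infinity>"
    using assms by (auto simp: real_integrable_def less_top)
  then show ?thesis
    unfolding ext_integral_def real_lebesgue_integral_def[OF assms]
    by (cases "\<integral>\<^sup>+x. ennreal (f x) \<partial>M"; cases "\<integral>\<^sup>+x. ennreal (- f x) \<partial>M")
       (auto simp: enn2ereal_ennreal)
qed

lemma integrable_if_ext_integral_finite:
  assumes "prob_space M" and f: "f \<in> borel_measurable M" and bdd: "bdd_below (range f)"
    and fin: "ext_integral M f < \<infinity>"
  shows "integrable M f"
proof -
  interpret prob_space M by fact
  obtain b where b: "\<And>x. b \<le> f x" using bdd by (auto simp: bdd_below_def)
  have "(\<integral>\<^sup>+x. ennreal (- f x) \<partial>M) \<le> (\<integral>\<^sup>+x. ennreal (- b) \<partial>M)"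
    using b by (intro nn_integral_mono ennreal_leI) simp
  also have "\<dots> < \<infinity>" by (simp add: emeasure_space_1)
  finally have neg: "(\<integral>\<^sup>+x. ennreal (- f x) \<partial>M) < \<infinity>" .
  moreover have "(\<integral>\<^sup>+x. ennreal (f x) \<partial>M) \<noteq> \<infinity>"
    using fin neg unfolding ext_integral_def
    by (cases "\<integral>\<^sup>+x. ennreal (- f x) \<partial>M") (auto simp: enn2ereal_ennreal)
  ultimately show ?thesis using f by (simp add: real_integrable_def)
qed

section \<open>Potentials for Lipschitz costs\<close>

text \<open>
  At each \<open>y\<close> the function \<open>\<psi>\<close> is touched from above by a translate of \<open>c(x, \<cdot>)\<close> for some \<open>x\<close>, and
  so inherits the Lipschitz constant of the cost in its second argument.
\<close>

lemma strongly_c_concave_lipschitz: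
  fixes c :: "'a::metric_space \<times> 'b::metric_space \<Rightarrow> real"
  assumes "strongly_c_concave_on D \<omega> c \<psi>"
    and lip: "\<And>p q. \<bar>c p - c q\<bar> \<le> L * sum_dist p q"
  shows "\<bar>\<psi> y - \<psi> z\<bar> \<le> L * dist y z"
proof -
  have *: "\<psi> z - \<psi> y \<le> L * dist y z" for y z
  proof -
    obtain x where "x \<in> c_superdifferential c \<psi> y"
      using assms(1) unfolding strongly_c_concave_on_def c_concave_def by blast
    then have "\<psi> z - c (x, z) \<le> \<psi> y - c (x, y)"
      by (simp add: c_superdifferential_def)
    then show ?thesis
      using lip[of "(x, z)" "(x, y)"] by (simp add: sum_dist_def dist_commute)
  qed
  show ?thesis using *[of y z] *[of z y] by (simp add: dist_commute abs_le_iff)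
qed

text \<open>
  A quadratic gap cannot persist at large distances against functions that grow linearly: for
  \<open>x\<close> in the superdifferential at \<open>y\<close>, the gap \<open>C d(y, z)^2\<close> is at most the sum of the variations of
  \<open>\<psi>\<close> and of \<open>c(x, \<cdot>)\<close> between \<open>y\<close> and \<open>z\<close>. This is what makes all potentials and transport
  displacements in the target space integrable.
\<close>

lemma strongly_c_concave_bounded_dist:
  fixes c :: "'a::metric_space \<times> 'b::metric_space \<Rightarrow> real" and y z :: 'b
  assumes sc: "strongly_c_concave_on UNIV (\<lambda>r. C * r\<^sup>2) c \<psi>" and "C > 0"
    and lip: "\<And>p q. \<bar>c p - c q\<bar> \<le> L * sum_dist p q" and "0 \<le> L"
  shows "dist y z \<le> 2 * L / C"
proof (cases "dist y z = 0")
  case False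
  then have pos: "dist y z > 0" by simp
  obtain x where "x \<in> c_superdifferential c \<psi> y"
    using sc unfolding strongly_c_concave_on_def c_concave_def by blast
  then have "\<psi> z - c (x, z) \<le> \<psi> y - c (x, y) - C * (dist y z)\<^sup>2"
    using sc by (simp add: strongly_c_concave_on_def)
  then have "C * (dist y z)\<^sup>2 \<le> (\<psi> y - \<psi> z) + (c (x, z) - c (x, y))" by simp
  also have "\<dots> \<le> L * dist y z + L * dist y z"
    using strongly_c_concave_lipschitz[OF sc lip, of y z] lip[of "(x, z)" "(x, y)"]
    by (simp add: sum_dist_def dist_commute)
  finally have "(C * dist y z) * dist y z \<le> (2 * L) * dist y z"
    by (simp add: power2_eq_square algebra_simps)
  then have "C * dist y z \<le> 2 * L" using pos by (simp only: mult_le_cancel_right_pos)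
  then show ?thesis using \<open>C > 0\<close> by (simp add: le_divide_eq mult.commute)
qed (use assms in simp)

section \<open>Stability of the optimal cost and of the plan\<close>

text \<open>
  The composed transport from \<open>\<mu>'\<close> along \<open>\<pi>\<close> to \<open>\<mu>\<close>, along \<open>T\<close> to \<open>\<nu>\<close> and along \<open>\<sigma>\<close> to \<open>\<nu>'\<close>
  competes with the optimal plan. It moves the endpoints of the pairs \<open>(x, T x)\<close> by the
  displacements of \<open>\<pi>\<close> and \<open>\<sigma>\<close>, plus \<open>\<delta>\<close> for the approximate gluing at \<open>T x\<close>.
\<close>

lemma optimal_cost_le_map_cost:
  fixes c :: "'a::polish_space \<times> 'b::polish_space \<Rightarrow> real"
  assumes \<pi>: "\<pi> \<in> transport_plans \<mu>' \<mu>" and \<sigma>: "\<sigma> \<in> transport_plans \<nu> \<nu>'"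
    and T: "T \<in> borel_measurable borel" and T\<mu>: "distr \<mu> borel T = \<nu>"
    and opt: "optimal_plan c \<mu>' \<nu>' \<gamma>'"
    and c\<gamma>': "integrable \<gamma>' c" and cT: "integrable \<mu> (\<lambda>x. c (x, T x))"
    and lip: "\<And>p q. \<bar>c p - c q\<bar> \<le> L * sum_dist p q" and L: "0 \<le> L"
    and d\<pi>: "integrable \<pi> (\<lambda>p. dist (fst p) (snd p))"
    and d\<sigma>: "integrable \<sigma> (\<lambda>p. dist (fst p) (snd p))"
    and "\<delta> > 0"
  shows "(\<integral>p. c p \<partial>\<gamma>') \<le> (\<integral>x. c (x, T x) \<partial>\<mu>)
    + L * ((\<integral>p. dist (fst p) (snd p) \<partial>\<pi>) + (\<integral>p. dist (fst p) (snd p) \<partial>\<sigma>) + \<delta>)"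
proof -
  note T[measurable]
  have c[measurable]: "c \<in> borel_measurable borel"
    using continuous_if_lipschitz_sum_dist[OF lip L] by (rule borel_measurable_continuous_onI)
  have s\<pi>[measurable_cong]: "sets \<pi> = sets (borel \<Otimes>\<^sub>M borel)"
    and s\<sigma>[measurable_cong]: "sets \<sigma> = sets (borel \<Otimes>\<^sub>M borel)"
    using transport_plansD(2)[OF \<pi>] transport_plansD(2)[OF \<sigma>] by (simp_all only: borel_prod)
  have [measurable]: "(\<lambda>p. T (snd p)) \<in> borel_measurable (borel :: ('a \<times> 'a) measure)"
    "fst \<in> borel_measurable (borel :: ('b \<times> 'b) measure)"
    by (simp_all add: borel_prod[symmetric])
  have "distr \<pi> borel (\<lambda>p. T (snd p)) = distr (distr \<pi> borel snd) borel T"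
    by (simp add: distr_distr comp_def)
  then have eq: "distr \<pi> borel (\<lambda>p. T (snd p)) = distr \<sigma> borel fst"
    using transport_plansD(4)[OF \<pi>] transport_plansD(3)[OF \<sigma>] T\<mu> by simp
  have bp: "\<pi> \<in> borel_prob" "\<sigma> \<in> borel_prob"
    using \<pi> \<sigma> by (auto simp: transport_plans_def)
  obtain S where S: "S \<in> transport_plans \<pi> \<sigma>"
    and near: "AE s in S. dist (T (snd (fst s))) (fst (snd s)) < \<delta>"
    using approximate_gluing[of \<pi> \<sigma> "\<lambda>p. T (snd p)" fst \<delta>] bp eq \<open>\<delta> > 0\<close> by auto
  interpret S: prob_space S using transport_plansD(1)[OF S] .
  have [measurable_cong]: "sets S = sets ((borel \<Otimes>\<^sub>M borel) \<Otimes>\<^sub>M (borel \<Otimes>\<^sub>M borel))"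
    using transport_plansD(2)[OF S] by (simp only: borel_prod)
  note mc = borel_measurable_compose_Pair[OF c]
  have mT: "(\<lambda>x. c (x, T x)) \<in> borel_measurable borel"
    by (rule mc) measurable
  have mT2: "(\<lambda>p::'a \<times> 'a. c (snd p, T (snd p))) \<in> borel_measurable borel"
    by (rule mc) (simp_all add: borel_prod[symmetric])
  have md: "(\<lambda>p::'a \<times> 'a. dist (fst p) (snd p)) \<in> borel_measurable borel"
    "(\<lambda>p::'b \<times> 'b. dist (fst p) (snd p)) \<in> borel_measurable borel"
    by (simp_all add: borel_prod[symmetric])
  \<comment> \<open>The points of \<open>S\<close> have the form \<open>((x', x), (y, y'))\<close> with \<open>T x\<close> close to \<open>y\<close>: the cost of \<open>T\<close>, the
    two displacements, and the cost of the competitor \<open>(x', y')\<close>.\<close>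
  define a where "a s = c (snd (fst s), T (snd (fst s)))" for s :: "('a \<times> 'a) \<times> ('b \<times> 'b)"
  define u where "u s = dist (fst (fst s)) (snd (fst s))" for s :: "('a \<times> 'a) \<times> ('b \<times> 'b)"
  define v where "v s = dist (fst (snd s)) (snd (snd s))" for s :: "('a \<times> 'a) \<times> ('b \<times> 'b)"
  define e where "e s = c (fst (fst s), snd (snd s))" for s :: "('a \<times> 'a) \<times> ('b \<times> 'b)"
  have ia: "integrable S a" and Ia: "(\<integral>s. a s \<partial>S) = (\<integral>x. c (x, T x) \<partial>\<mu>)"
    unfolding a_def
    using integrable_fst_marginal[OF S mT2] integrable_snd_marginal[OF \<pi> mT]
      integral_fst_marginal[OF S mT2] integral_snd_marginal[OF \<pi> mT] cT by auto
  have iu: "integrable S u" and Iu: "(\<integral>s. u s \<partial>S) = (\<integral>p. dist (fst p) (snd p) \<partial>\<pi>)"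
    unfolding u_def
    using integrable_fst_marginal[OF S md(1)] integral_fst_marginal[OF S md(1)] d\<pi> by auto
  have iv: "integrable S v" and Iv: "(\<integral>s. v s \<partial>S) = (\<integral>p. dist (fst p) (snd p) \<partial>\<sigma>)"
    unfolding v_def
    using integrable_snd_marginal[OF S md(2)] integral_snd_marginal[OF S md(2)] d\<sigma> by auto
  have me: "e \<in> borel_measurable S"
    unfolding e_def by (rule mc) measurable
  have close: "AE s in S. \<bar>e s - a s\<bar> \<le> L * (u s + v s + \<delta>)"
    using near
  proof eventually_elim
    fix s :: "('a \<times> 'a) \<times> ('b \<times> 'b)"
    assume n: "dist (T (snd (fst s))) (fst (snd s)) < \<delta>"
    have "dist (snd (snd s)) (T (snd (fst s))) \<le> v s + \<delta>"
      using n dist_triangle[of "snd (snd s)" "T (snd (fst s))" "fst (snd s)"]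
      by (simp add: v_def dist_commute)
    then have "sum_dist (fst (fst s), snd (snd s)) (snd (fst s), T (snd (fst s))) \<le> u s + v s + \<delta>"
      by (simp add: sum_dist_def u_def)
    then show "\<bar>e s - a s\<bar> \<le> L * (u s + v s + \<delta>)"
      using lip[of "(fst (fst s), snd (snd s))" "(snd (fst s), T (snd (fst s)))"]
        mult_left_mono[OF _ L] unfolding e_def a_def by fastforce
  qed
  have ie: "integrable S e"
  proof (rule Bochner_Integration.integrable_bound)
    show "integrable S (\<lambda>s. \<bar>a s\<bar> + L * (u s + v s + \<delta>))" using ia iu iv by auto
    show "AE s in S. norm (e s) \<le> norm (\<bar>a s\<bar> + L * (u s + v s + \<delta>))"
      using close by eventually_elim auto
  qed (rule me)
  define \<rho> where "\<rho> = distr S borel (\<lambda>s. (fst (fst s), snd (snd s)))"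
  have mp: "(\<lambda>s. (fst (fst s), snd (snd s))) \<in> S \<rightarrow>\<^sub>M borel"
    by (simp add: borel_prod[symmetric])
  have "distr S borel (\<lambda>s. fst (fst s)) = distr (distr S borel fst) borel fst"
    "distr S borel (\<lambda>s. snd (snd s)) = distr (distr S borel snd) borel snd"
    by (simp_all add: distr_distr comp_def borel_prod[symmetric])
  then have \<rho>: "\<rho> \<in> transport_plans \<mu>' \<nu>'"
    unfolding \<rho>_def
    using transport_plansD(3,4)[OF S] transport_plansD(3)[OF \<pi>] transport_plansD(4)[OF \<sigma>]
    by (intro distr_transport_plan S.prob_space_axioms) simp_all
  have i\<rho>: "integrable \<rho> c" and I\<rho>: "(\<integral>p. c p \<partial>\<rho>) = (\<integral>s. e s \<partial>S)"
    unfolding \<rho>_def using ie integrable_distr_eq[OF mp c] integral_distr[OF mp c]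
    by (simp_all add: e_def[abs_def])
  have "(\<integral>p. c p \<partial>\<gamma>') \<le> (\<integral>p. c p \<partial>\<rho>)"
    using opt \<rho> unfolding optimal_plan_def is_arg_min_def
    by (auto simp: ext_integral_eq_integral[OF c\<gamma>'] ext_integral_eq_integral[OF i\<rho>] not_less)
  also have "\<dots> \<le> (\<integral>s. a s + L * (u s + v s + \<delta>) \<partial>S)"
    unfolding I\<rho> using ie ia iu iv close by (intro integral_mono_AE) auto
  also have "\<dots> = (\<integral>s. a s \<partial>S) + L * ((\<integral>s. u s \<partial>S) + (\<integral>s. v s \<partial>S) + \<delta>)"
    using ia iu iv by (simp add: S.prob_space)
  finally show ?thesis by (simp add: Ia Iu Iv)
qed

text \<open>
  The quantitative core, for arbitrary couplings \<open>\<pi>\<close> and \<open>\<sigma>\<close> with finite mean displacement. The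
  extra \<open>\<delta>\<close> is the error of the approximate gluing; it tends to \<open>0\<close> afterwards.
\<close>

lemma W1_plan_of_map_le:
  fixes c :: "'a::polish_space \<times> 'b::polish_space \<Rightarrow> real"
  assumes \<pi>: "\<pi> \<in> transport_plans \<mu>' \<mu>" and \<sigma>: "\<sigma> \<in> transport_plans \<nu> \<nu>'"
    and T: "T \<in> borel_measurable borel" and T\<mu>: "distr \<mu> borel T = \<nu>"
    and s\<mu>: "sets \<mu> = sets borel"
    and opt: "optimal_plan c \<mu>' \<nu>' \<gamma>'"
    and c\<gamma>': "integrable \<gamma>' c"
    and ind: "induced_by c \<psi> T"
    and C: "C > 0"
    and sc: "strongly_c_concave_on UNIV (\<lambda>r. C * r\<^sup>2) c \<psi>"
    and lip: "\<And>p q. \<bar>c p - c q\<bar> \<le> L * sum_dist p q" and L: "0 \<le> L"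
    and d\<pi>: "integrable \<pi> (\<lambda>p. dist (fst p) (snd p))"
    and d\<sigma>: "integrable \<sigma> (\<lambda>p. dist (fst p) (snd p))"
    and "\<delta> > 0"
    and I: "I = (\<integral>p. dist (fst p) (snd p) \<partial>\<pi>)"
    and J: "J = (\<integral>p. dist (fst p) (snd p) \<partial>\<sigma>)"
  shows "W1 sum_dist (plan_of_map \<mu> T) \<gamma>'
    \<le> ennreal (I + \<delta> + sqrt (2 * L / C * (I + J + \<delta>)))"
proof -
  note T[measurable]
  note s\<mu>[measurable_cong]
  have c[measurable]: "c \<in> borel_measurable borel"
    using continuous_if_lipschitz_sum_dist[OF lip L] by (rule borel_measurable_continuous_onI)
  have \<gamma>': "\<gamma>' \<in> transport_plans \<mu>' \<nu>'"
    using opt by (simp add: optimal_plan_def is_arg_min_def)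
  define B where "B = 2 * L / C"
  have B: "dist y z \<le> B" for y z :: 'b
    unfolding B_def by (rule strongly_c_concave_bounded_dist[OF sc C lip L])
  have \<psi>lip: "\<bar>\<psi> y - \<psi> z\<bar> \<le> L * dist y z" for y z
    by (rule strongly_c_concave_lipschitz[OF sc lip])
  have "continuous_on UNIV \<psi>"
    using \<psi>lip L by (intro lipschitz_on_continuous_on[of L] lipschitz_onI) (auto simp: dist_real_def)
  then have \<psi>[measurable]: "\<psi> \<in> borel_measurable borel" by (rule borel_measurable_continuous_onI)
  have \<psi>int: "integrable M \<psi>" if "prob_space M" "sets M = sets borel" for M
  proof -
    interpret M: prob_space M by fact
    have "\<bar>\<psi> y\<bar> \<le> \<bar>\<psi> undefined\<bar> + L * B" for y
      using \<psi>lip[of y undefined] mult_left_mono[OF B[of y undefined] L] by linarith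
    then show ?thesis
      using that(2) by (intro M.integrable_const_bound[of _ "\<bar>\<psi> undefined\<bar> + L * B"])
        (auto simp: measurable_cong_sets[OF that(2) refl])
  qed
  have s\<pi>[measurable_cong]: "sets \<pi> = sets (borel \<Otimes>\<^sub>M borel)"
    and s\<gamma>'[measurable_cong]: "sets \<gamma>' = sets (borel \<Otimes>\<^sub>M borel)"
    using transport_plansD(2)[OF \<pi>] transport_plansD(2)[OF \<gamma>'] by (simp_all only: borel_prod)
  have [measurable]: "fst \<in> borel_measurable (borel :: ('a \<times> 'a) measure)"
    "fst \<in> borel_measurable (borel :: ('a \<times> 'b) measure)"
    by (simp_all add: borel_prod[symmetric])
  have bp: "\<pi> \<in> borel_prob" "\<gamma>' \<in> borel_prob"
    using \<pi> \<gamma>' by (auto simp: transport_plans_def)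
  \<comment> \<open>The points of \<open>R\<close> have the form \<open>((x1, x), (x2, y))\<close> with \<open>x1\<close> close to \<open>x2\<close>.\<close>
  have "distr \<pi> borel fst = distr \<gamma>' borel fst"
    using transport_plansD(3)[OF \<pi>] transport_plansD(3)[OF \<gamma>'] by simp
  then obtain R where R: "R \<in> transport_plans \<pi> \<gamma>'"
    and near: "AE r in R. dist (fst (fst r)) (fst (snd r)) < \<delta>"
    using approximate_gluing[of \<pi> \<gamma>' fst fst \<delta>] bp \<open>\<delta> > 0\<close> by auto
  interpret R: prob_space R using transport_plansD(1)[OF R] .
  have [measurable_cong]: "sets R = sets ((borel \<Otimes>\<^sub>M borel) \<Otimes>\<^sub>M (borel \<Otimes>\<^sub>M borel))"
    using transport_plansD(2)[OF R] by (simp only: borel_prod)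
  note mc = borel_measurable_compose_Pair[OF c]
  have mT: "(\<lambda>x. c (x, T x)) \<in> borel_measurable borel"
    by (rule mc) measurable
  have mT2: "(\<lambda>p::'a \<times> 'a. c (snd p, T (snd p))) \<in> borel_measurable borel"
    by (rule mc) (simp_all add: borel_prod[symmetric])
  have md: "(\<lambda>p::'a \<times> 'a. dist (fst p) (snd p)) \<in> borel_measurable borel"
    by (simp add: borel_prod[symmetric])
  have m\<psi>T: "(\<lambda>p::'a \<times> 'a. \<psi> (T (snd p))) \<in> borel_measurable borel"
    and m\<psi>s: "(\<lambda>p::'a \<times> 'b. \<psi> (snd p)) \<in> borel_measurable borel"
    by (simp_all add: borel_prod[symmetric])
  define a where "a r = c (snd (fst r), T (snd (fst r)))" for r :: "('a \<times> 'a) \<times> ('a \<times> 'b)"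
  define b where "b r = c (snd r)" for r :: "('a \<times> 'a) \<times> ('a \<times> 'b)"
  define u where "u r = dist (fst (fst r)) (snd (fst r))" for r :: "('a \<times> 'a) \<times> ('a \<times> 'b)"
  define w where "w r = dist (T (snd (fst r))) (snd (snd r))" for r :: "('a \<times> 'a) \<times> ('a \<times> 'b)"
  define p where "p r = \<psi> (T (snd (fst r)))" for r :: "('a \<times> 'a) \<times> ('a \<times> 'b)"
  define q where "q r = \<psi> (snd (snd r))" for r :: "('a \<times> 'a) \<times> ('a \<times> 'b)"
  have ib: "integrable R b" and Ib: "(\<integral>r. b r \<partial>R) = (\<integral>z. c z \<partial>\<gamma>')"
    unfolding b_def
    using integrable_snd_marginal[OF R c] integral_snd_marginal[OF R c] c\<gamma>' by auto
  have iu: "integrable R u" and Iu: "(\<integral>r. u r \<partial>R) = I"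
    unfolding u_def I
    using integrable_fst_marginal[OF R md] integral_fst_marginal[OF R md] d\<pi> by auto
  have mw: "w \<in> borel_measurable R" unfolding w_def by measurable
  have iw: "integrable R w"
    using mw B by (intro R.integrable_const_bound[of _ B]) (auto simp: w_def)
  have iw2: "integrable R (\<lambda>r. (w r)\<^sup>2)"
    using mw B by (intro R.integrable_const_bound[of _ "B\<^sup>2"]) (auto simp: w_def intro!: power_mono)
  have near': "AE r in R. dist (snd (fst r)) (fst (snd r)) \<le> u r + \<delta>"
    using near
  proof eventually_elim
    fix r :: "('a \<times> 'a) \<times> ('a \<times> 'b)"
    assume "dist (fst (fst r)) (fst (snd r)) < \<delta>"
    then show "dist (snd (fst r)) (fst (snd r)) \<le> u r + \<delta>"
      using dist_triangle[of "snd (fst r)" "fst (snd r)" "fst (fst r)"]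
      by (simp add: u_def dist_commute)
  qed
  have ma: "a \<in> borel_measurable R" unfolding a_def by (rule mc) measurable
  \<comment> \<open>The cost of \<open>T\<close> is integrable by comparison with that of \<open>\<gamma>'\<close>: the pairs \<open>(x, T x)\<close> and
    \<open>(x2, y)\<close> lie at integrable distance because the target space is bounded.\<close>
  have ia: "integrable R a"
  proof (rule Bochner_Integration.integrable_bound)
    show "integrable R (\<lambda>r. \<bar>b r\<bar> + L * (u r + \<delta> + w r))" using ib iu iw by auto
    show "AE r in R. norm (a r) \<le> norm (\<bar>b r\<bar> + L * (u r + \<delta> + w r))"
      using near'
    proof eventually_elim
      fix r :: "('a \<times> 'a) \<times> ('a \<times> 'b)"
      assume "dist (snd (fst r)) (fst (snd r)) \<le> u r + \<delta>"
      then have "sum_dist (snd (fst r), T (snd (fst r))) (snd r) \<le> u r + \<delta> + w r"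
        by (simp add: sum_dist_def w_def)
      then show "norm (a r) \<le> norm (\<bar>b r\<bar> + L * (u r + \<delta> + w r))"
        using lip[of "(snd (fst r), T (snd (fst r)))" "snd r"] mult_left_mono[OF _ L]
        unfolding a_def b_def by fastforce
    qed
  qed (rule ma)
  have ia\<mu>: "integrable \<mu> (\<lambda>x. c (x, T x))" and Ia: "(\<integral>r. a r \<partial>R) = (\<integral>x. c (x, T x) \<partial>\<mu>)"
    using integrable_fst_marginal[OF R mT2] integrable_snd_marginal[OF \<pi> mT]
      integral_fst_marginal[OF R mT2] integral_snd_marginal[OF \<pi> mT] ia
    unfolding a_def by auto
  \<comment> \<open>The mean of \<open>\<psi>(T x) - \<psi>(y)\<close> depends only on \<open>\<nu>\<close> and \<open>\<nu>'\<close>, so it may be computed along \<open>\<sigma>\<close>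
    instead of \<open>R\<close>.\<close>
  have R\<sigma>: "(\<integral>r. p r \<partial>R) - (\<integral>r. q r \<partial>R) \<le> L * J"
    and ip: "integrable R p" and iq: "integrable R q"
  proof -
    have \<psi>\<nu>: "integrable \<nu> \<psi>" "integrable \<nu>' \<psi>"
      using \<psi>int transport_plan_marginals[OF \<sigma>] by (auto simp: borel_prob_def)
    have m: "(\<lambda>x. \<psi> (T x)) \<in> borel_measurable borel" by measurable
    have T': "T \<in> \<mu> \<rightarrow>\<^sub>M borel" by measurable
    have "integrable \<mu> (\<lambda>x. \<psi> (T x))" "(\<integral>x. \<psi> (T x) \<partial>\<mu>) = (\<integral>y. \<psi> y \<partial>\<nu>)"
      using integrable_distr_eq[OF T' \<psi>] integral_distr[OF T' \<psi>] \<psi>\<nu> T\<mu> by simp_all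
    then show "integrable R p" and p: "integrable R q"
      using integrable_fst_marginal[OF R m\<psi>T] integrable_snd_marginal[OF \<pi> m] \<psi>\<nu>
        integrable_snd_marginal[OF R m\<psi>s] integrable_snd_marginal[OF \<gamma>' \<psi>]
      unfolding p_def q_def by auto
    have "(\<integral>r. p r \<partial>R) - (\<integral>r. q r \<partial>R) = (\<integral>y. \<psi> y \<partial>\<nu>) - (\<integral>y. \<psi> y \<partial>\<nu>')"
      using integral_fst_marginal[OF R m\<psi>T] integral_snd_marginal[OF \<pi> m]
        integral_snd_marginal[OF R m\<psi>s] integral_snd_marginal[OF \<gamma>' \<psi>]
        \<open>(\<integral>x. \<psi> (T x) \<partial>\<mu>) = (\<integral>y. \<psi> y \<partial>\<nu>)\<close>
      unfolding p_def q_def by simp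
    also have "\<dots> = (\<integral>z. \<psi> (fst z) - \<psi> (snd z) \<partial>\<sigma>)"
      using \<psi>\<nu> integrable_fst_marginal[OF \<sigma> \<psi>] integrable_snd_marginal[OF \<sigma> \<psi>]
        integral_fst_marginal[OF \<sigma> \<psi>] integral_snd_marginal[OF \<sigma> \<psi>] by simp
    also have "\<dots> \<le> (\<integral>z. L * dist (fst z) (snd z) \<partial>\<sigma>)"
      using \<psi>\<nu> integrable_fst_marginal[OF \<sigma> \<psi>] integrable_snd_marginal[OF \<sigma> \<psi>] d\<sigma>
      by (intro integral_mono) (auto intro: order_trans[OF abs_ge_self \<psi>lip])
    finally show "(\<integral>r. p r \<partial>R) - (\<integral>r. q r \<partial>R) \<le> L * J" by (simp add: J)
  qed
  \<comment> \<open>Strong concavity at \<open>T x\<close> against the competitor \<open>y\<close>, with \<open>c(x, y)\<close> replaced by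
    \<open>c(x2, y)\<close>.\<close>
  have pw: "AE r in R. C * (w r)\<^sup>2 \<le> (b r - a r) + L * (u r + \<delta>) + (p r - q r)"
    using near'
  proof eventually_elim
    fix r :: "('a \<times> 'a) \<times> ('a \<times> 'b)"
    obtain x1 x x2 y where r: "r = ((x1, x), (x2, y))" by (metis surj_pair)
    assume "dist (snd (fst r)) (fst (snd r)) \<le> u r + \<delta>"
    then have "L * dist x x2 \<le> L * (u r + \<delta>)" using L r by (intro mult_left_mono) simp_all
    then have "c (x, y) \<le> c (x2, y) + L * (u r + \<delta>)"
      using lip[of "(x, y)" "(x2, y)"] by (simp add: sum_dist_def)
    moreover have "x \<in> c_superdifferential c \<psi> (T x)"
      using ind by (simp add: induced_by_def is_arg_min_def c_superdifferential_def not_less algebra_simps)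
    then have "\<psi> y - c (x, y) \<le> \<psi> (T x) - c (x, T x) - C * (dist (T x) y)\<^sup>2"
      using sc by (simp add: strongly_c_concave_on_def)
    ultimately show "C * (w r)\<^sup>2 \<le> (b r - a r) + L * (u r + \<delta>) + (p r - q r)"
      by (simp add: r a_def b_def w_def p_def q_def)
  qed
  have "C * (\<integral>r. (w r)\<^sup>2 \<partial>R) = (\<integral>r. C * (w r)\<^sup>2 \<partial>R)" by simp
  also have "\<dots> \<le> (\<integral>r. (b r - a r) + L * (u r + \<delta>) + (p r - q r) \<partial>R)"
    using iw2 ib ia iu ip iq pw by (intro integral_mono_AE) auto
  also have "\<dots> = (\<integral>r. b r \<partial>R) - (\<integral>r. a r \<partial>R) + L * (I + \<delta>) + ((\<integral>r. p r \<partial>R) - (\<integral>r. q r \<partial>R))"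
    using ib ia iu ip iq by (simp add: R.prob_space Iu)
  also have "\<dots> \<le> L * (I + J + \<delta>) + L * (I + \<delta>) + L * J"
    using optimal_cost_le_map_cost[OF \<pi> \<sigma> T T\<mu> opt c\<gamma>' ia\<mu> lip L d\<pi> d\<sigma> \<open>\<delta> > 0\<close>] R\<sigma>
    unfolding Ia Ib I J by linarith
  also have "\<dots> = 2 * L * (I + J + \<delta>)" by (simp add: algebra_simps)
  finally have w2: "(\<integral>r. (w r)\<^sup>2 \<partial>R) \<le> 2 * L / C * (I + J + \<delta>)"
    using C by (simp add: field_simps)
  \<comment> \<open>Jensen's inequality in the form that a variance is nonnegative.\<close>
  have "(\<integral>r. w r \<partial>R)\<^sup>2 \<le> (\<integral>r. (w r)\<^sup>2 \<partial>R)"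
    using R.variance_eq[OF iw iw2] R.variance_positive[of w] by linarith
  then have w1: "(\<integral>r. w r \<partial>R) \<le> sqrt (2 * L / C * (I + J + \<delta>))"
    using w2 by (intro real_le_rsqrt) linarith
  define G where "G = distr R borel (\<lambda>r. ((snd (fst r), T (snd (fst r))), snd r))"
  have m1: "(\<lambda>r. (snd (fst r), T (snd (fst r)))) \<in> R \<rightarrow>\<^sub>M borel"
    by (simp add: borel_prod[symmetric])
  have m2: "snd \<in> R \<rightarrow>\<^sub>M borel" by (simp add: borel_prod[symmetric])
  have "distr R borel (\<lambda>r. (snd (fst r), T (snd (fst r))))
      = distr (distr (distr R borel fst) borel snd) borel (\<lambda>x. (x, T x))"
    by (simp add: distr_distr comp_def borel_prod[symmetric])
  also have "\<dots> = plan_of_map \<mu> T"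
    using transport_plansD(3)[OF R] transport_plansD(4)[OF \<pi>] by (simp add: plan_of_map_def)
  finally have G: "G \<in> transport_plans (plan_of_map \<mu> T) \<gamma>'"
    unfolding G_def using transport_plansD(4)[OF R] m1 m2
    by (intro distr_transport_plan R.prob_space_axioms) simp_all
  have mG: "(\<lambda>r. ((snd (fst r), T (snd (fst r))), snd r)) \<in> R \<rightarrow>\<^sub>M borel"
    using m1 m2 by (simp add: borel_prod[symmetric])
  have ms: "(\<lambda>z :: ('a \<times> 'b) \<times> ('a \<times> 'b). sum_dist (fst z) (snd z)) \<in> borel_measurable borel"
    unfolding sum_dist_def by (simp add: borel_prod[symmetric])
  have "W1 sum_dist (plan_of_map \<mu> T) \<gamma>' \<le> (\<integral>\<^sup>+z. ennreal (sum_dist (fst z) (snd z)) \<partial>G)"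
    unfolding W1_def by (rule INF_lower[OF G])
  also have "\<dots> = (\<integral>\<^sup>+r. ennreal (dist (snd (fst r)) (fst (snd r)) + w r) \<partial>R)"
    unfolding G_def using measurable_compose[OF ms measurable_ennreal]
    by (subst nn_integral_distr[OF mG]) (simp_all add: sum_dist_def w_def del: ennreal_plus)
  also have "\<dots> \<le> (\<integral>\<^sup>+r. ennreal (u r + \<delta> + w r) \<partial>R)"
    using near' by (intro nn_integral_mono_AE) (auto elim!: eventually_mono intro!: ennreal_leI)
  also have "\<dots> = ennreal (\<integral>r. u r + \<delta> + w r \<partial>R)"
  proof (rule nn_integral_eq_integral)
    show "integrable R (\<lambda>r. u r + \<delta> + w r)" using iu iw by simp
    show "AE r in R. 0 \<le> u r + \<delta> + w r" using \<open>\<delta> > 0\<close> by (simp add: u_def w_def)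
  qed
  also have "(\<integral>r. u r + \<delta> + w r \<partial>R) = I + \<delta> + (\<integral>r. w r \<partial>R)"
    using iu iw by (simp add: R.prob_space Iu)
  finally show ?thesis
    using w1 by (elim order_trans) (intro ennreal_leI, simp)
qed

lemma almost_optimal_W1_plan:
  fixes \<mu> \<nu> :: "'a::polish_space measure"
  assumes "W1 dist \<mu> \<nu> < \<infinity>" and "0 < \<eta>"
  obtains \<pi> where "\<pi> \<in> transport_plans \<mu> \<nu>" "integrable \<pi> (\<lambda>p. dist (fst p) (snd p))"
    "(\<integral>p. dist (fst p) (snd p) \<partial>\<pi>) < enn2real (W1 dist \<mu> \<nu>) + \<eta>"
proof -
  have "W1 dist \<mu> \<nu> < ennreal (enn2real (W1 dist \<mu> \<nu>) + \<eta>)"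
    using assms by (cases "W1 dist \<mu> \<nu>") (auto simp: ennreal_less_iff)
  then obtain \<pi> where \<pi>: "\<pi> \<in> transport_plans \<mu> \<nu>"
    and less: "(\<integral>\<^sup>+p. ennreal (dist (fst p) (snd p)) \<partial>\<pi>) < ennreal (enn2real (W1 dist \<mu> \<nu>) + \<eta>)"
    unfolding W1_def INF_less_iff by blast
  have [measurable_cong]: "sets \<pi> = sets (borel \<Otimes>\<^sub>M borel)"
    using transport_plansD(2)[OF \<pi>] by (simp only: borel_prod)
  have int: "integrable \<pi> (\<lambda>p. dist (fst p) (snd p))"
    using less by (intro integrableI_nonneg) (auto intro: less_trans)
  then have "(\<integral>\<^sup>+p. ennreal (dist (fst p) (snd p)) \<partial>\<pi>) = ennreal (\<integral>p. dist (fst p) (snd p) \<partial>\<pi>)"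
    by (intro nn_integral_eq_integral) auto
  then have "(\<integral>p. dist (fst p) (snd p) \<partial>\<pi>) < enn2real (W1 dist \<mu> \<nu>) + \<eta>"
    using less by (simp add: ennreal_less_iff)
  with \<pi> int show ?thesis by (rule that)
qed

theorem proposition10:
  fixes \<mu> \<mu>' :: "'a::polish_space measure"
    and \<nu> \<nu>' :: "'b::polish_space measure"
    and c :: "'a \<times> 'b \<Rightarrow> real"
    and T :: "'a \<Rightarrow> 'b"
    and \<gamma>' :: "('a \<times> 'b) measure"
    and \<psi> :: "'b \<Rightarrow> real"
    and C :: real
  assumes "\<mu> \<in> borel_prob" and "\<mu>' \<in> borel_prob"
    and "\<nu> \<in> borel_prob" and "\<nu>' \<in> borel_prob"
    and "bdd_below (range c)"
    and "is_lipschitz sum_dist c"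
    and "optimal_map c \<mu> \<nu> T"
    and "optimal_plan c \<mu>' \<nu>' \<gamma>'"
    and finite_cost: "ext_integral \<gamma>' c < \<infinity>"
    and "induced_by c \<psi> T"
    and "C > 0"
    and "strongly_c_concave_on (UNIV \<times> UNIV) (\<lambda>r. C * r\<^sup>2) c \<psi>"
  shows "let \<epsilon> = W1 dist \<mu>' \<mu> + W1 dist \<nu> \<nu>' in
    W1 sum_dist (plan_of_map \<mu> T) \<gamma>'
      \<le> \<epsilon> + ennreal_sqrt (ennreal (2 * Lip sum_dist c / C) * \<epsilon>)"
proof -
  define L where "L = Lip sum_dist c"
  have lip: "\<bar>c p - c q\<bar> \<le> L * sum_dist p q" and L: "0 \<le> L" for p q
    using Lip_bound[OF assms(6)] unfolding L_def by (simp_all add: sum_dist_def)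
  define \<epsilon> where "\<epsilon> = W1 dist \<mu>' \<mu> + W1 dist \<nu> \<nu>'"
  define K where "K = 2 * L / C"
  have K: "0 \<le> K" using L \<open>C > 0\<close> by (simp add: K_def)
  have "W1 sum_dist (plan_of_map \<mu> T) \<gamma>' \<le> \<epsilon> + ennreal_sqrt (ennreal K * \<epsilon>)"
  proof (cases "\<epsilon> = \<infinity>")
    case False
    define e where "e = enn2real \<epsilon>"
    have e: "\<epsilon> = ennreal e" "0 \<le> e" using False by (simp_all add: e_def less_top)
    have fin: "W1 dist \<mu>' \<mu> < \<infinity>" "W1 dist \<nu> \<nu>' < \<infinity>"
      using False by (auto simp: \<epsilon>_def less_top)
    have e_eq: "e = enn2real (W1 dist \<mu>' \<mu>) + enn2real (W1 dist \<nu> \<nu>')"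
      unfolding e_def \<epsilon>_def using fin by (intro enn2real_plus) simp_all
    have s\<mu>: "sets \<mu> = sets borel" using assms(1) by (simp add: borel_prob_def)
    have T: "T \<in> borel_measurable borel" "distr \<mu> borel T = \<nu>"
      using assms(7) measurable_cong_sets[OF s\<mu> refl]
      by (auto simp: optimal_map_def is_arg_min_def transport_maps_def)
    have \<gamma>': "\<gamma>' \<in> transport_plans \<mu>' \<nu>'"
      using assms(8) by (simp add: optimal_plan_def is_arg_min_def)
    have "c \<in> borel_measurable \<gamma>'"
      using borel_measurable_continuous_onI[OF continuous_if_lipschitz_sum_dist[OF lip L]]
      by (simp add: measurable_cong_sets[OF transport_plansD(2)[OF \<gamma>'] refl])
    then have c\<gamma>': "integrable \<gamma>' c"
      using integrable_if_ext_integral_finite transport_plansD(1)[OF \<gamma>'] assms(5) finite_cost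
      by blast
    have sc: "strongly_c_concave_on UNIV (\<lambda>r. C * r\<^sup>2) c \<psi>" using assms(12) by simp
    have bound: "W1 sum_dist (plan_of_map \<mu> T) \<gamma>' \<le> ennreal (e + \<eta> + sqrt (K * (e + \<eta>)))"
      if "0 < \<eta>" for \<eta>
    proof -
      \<comment> \<open>One third of the slack for each of the two couplings and for the gluing error.\<close>
      have \<eta>: "0 < \<eta> / 3" using that by simp
      obtain \<pi> where \<pi>: "\<pi> \<in> transport_plans \<mu>' \<mu>" "integrable \<pi> (\<lambda>p. dist (fst p) (snd p))"
        "(\<integral>p. dist (fst p) (snd p) \<partial>\<pi>) < enn2real (W1 dist \<mu>' \<mu>) + \<eta> / 3"
        using almost_optimal_W1_plan[OF fin(1) \<eta>] by blast
      obtain \<sigma> where \<sigma>: "\<sigma> \<in> transport_plans \<nu> \<nu>'" "integrable \<sigma> (\<lambda>p. dist (fst p) (snd p))"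
        "(\<integral>p. dist (fst p) (snd p) \<partial>\<sigma>) < enn2real (W1 dist \<nu> \<nu>') + \<eta> / 3"
        using almost_optimal_W1_plan[OF fin(2) \<eta>] by blast
      define I where "I = (\<integral>p. dist (fst p) (snd p) \<partial>\<pi>)"
      define J where "J = (\<integral>p. dist (fst p) (snd p) \<partial>\<sigma>)"
      have "0 \<le> J" by (simp add: J_def)
      then have IJ: "I + J + \<eta> / 3 \<le> e + \<eta>" "I + \<eta> / 3 \<le> e + \<eta>"
        using \<pi>(3) \<sigma>(3) that unfolding I_def[symmetric] J_def[symmetric] e_eq by linarith+
      have "W1 sum_dist (plan_of_map \<mu> T) \<gamma>' \<le> ennreal (I + \<eta> / 3 + sqrt (K * (I + J + \<eta> / 3)))"
        unfolding K_def
        by (rule W1_plan_of_map_le[OF \<pi>(1) \<sigma>(1) T s\<mu> assms(8) c\<gamma>' assms(10) \<open>C > 0\<close> sc lip L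
              \<pi>(2) \<sigma>(2) \<eta> I_def J_def])
      also have "\<dots> \<le> ennreal (e + \<eta> + sqrt (K * (e + \<eta>)))"
        by (intro ennreal_leI add_mono[OF IJ(2)] real_sqrt_le_mono mult_left_mono[OF IJ(1) K])
      finally show ?thesis .
    qed
    have "((\<lambda>\<eta>. ennreal (e + \<eta> + sqrt (K * (e + \<eta>)))) \<longlongrightarrow> ennreal (e + 0 + sqrt (K * (e + 0)))) (at_right 0)"
      by (intro tendsto_intros tendsto_ennrealI)
    then have "W1 sum_dist (plan_of_map \<mu> T) \<gamma>' \<le> ennreal (e + 0 + sqrt (K * (e + 0)))"
      by (rule tendsto_lowerbound) (auto simp: bound eventually_at_filter)
    then show ?thesis
      using e K by (simp add: ennreal_sqrt_def ennreal_mult[symmetric])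
  qed simp
  then show ?thesis by (simp add: \<epsilon>_def K_def L_def)
qed

end
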